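(* Let $\nu$ be a probability measure on $[0,\infty[$ with finite fourth moment $m_4(\nu):=\int_0^\infty x^4\,d\nu(x)<\infty$, and put $\sigma^2:=\int_0^\infty x^2\,d\nu(x)$. Let $(p_n)_{n\ge1}\subset\mathbb{N}$ be a sequence of dimensions with $\lim_{n\to\infty} n^2/p_n=0$. Then the random variables $$\frac{\|S_n^{p_n}\|_2^2-n\sigma^2}{\sqrt n}$$ converge in distribution for $n\to\infty$ to the normal distribution $N(0,m_4(\nu)-\sigma^4)$ on $\mathbb{R}$.
   Context: For each $p\in\mathbb{N}$, $\nu_p$ denotes the unique radial (i.e. invariant under all orthogonal transformations) probability measure on $\mathbb{R}^p$ whose image under the map $x\mapsto\|x\|_2$ (Euclidean norm) is $\nu$. For each $p\in\mathbb{N}$, $(X_k^p)_{k\ge1}$ are i.i.d. $\mathbb{R}^p$-valued random variables with law $\nu_p$, and $S_n^p:=\sum_{k=1}^n X_k^p$. A normal distribution with variance $0$ is the point measure at its mean; $\sigma^4=(\sigma^2)^2$. *)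

theory Defs
  imports "HOL-Probability.Probability"
begin

text \<open>
  The dimension varies along the sequence in the theorem, so \<open>\<real>\<^sup>d\<close> cannot be a fixed
  \<open>euclidean_space\<close> type. It is represented by the product measurable space over the index
  set \<open>{..<d}\<close>, whose elements are the extensional functions on \<open>{..<d}\<close>; its
  \<open>\<sigma>\<close>-algebra is the Borel \<open>\<sigma>\<close>-algebra of \<open>\<real>\<^sup>d\<close>.
\<close>

definition borel_vec :: "nat \<Rightarrow> (nat \<Rightarrow> real) measure" where
  "borel_vec d = (\<Pi>\<^sub>M i\<in>{..<d}. borel)"

definition vec_norm :: "nat \<Rightarrow> (nat \<Rightarrow> real) \<Rightarrow> real" where
  "vec_norm d x = L2_set x {..<d}"

definition vec_sum :: "nat \<Rightarrow> ('k \<Rightarrow> nat \<Rightarrow> real) \<Rightarrow> 'k set \<Rightarrow> nat \<Rightarrow> real" where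
  "vec_sum d x K = (\<lambda>i\<in>{..<d}. \<Sum>k\<in>K. x k i)"

definition mat_apply :: "nat \<Rightarrow> (nat \<Rightarrow> nat \<Rightarrow> real) \<Rightarrow> (nat \<Rightarrow> real) \<Rightarrow> (nat \<Rightarrow> real)" where
  "mat_apply d A x = (\<lambda>i\<in>{..<d}. \<Sum>j<d. A i j * x j)"

text \<open>Orthogonality in the form \<open>A\<^sup>T A = I\<close>; entries outside \<open>{..<d} \<times> {..<d}\<close> are irrelevant.\<close>

definition orthogonal_mat :: "nat \<Rightarrow> (nat \<Rightarrow> nat \<Rightarrow> real) \<Rightarrow> bool" where
  "orthogonal_mat d A \<longleftrightarrow>
     (\<forall>i<d. \<forall>j<d. (\<Sum>k<d. A k i * A k j) = (if i = j then 1 else 0))"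

definition radial_measure :: "nat \<Rightarrow> (nat \<Rightarrow> real) measure \<Rightarrow> bool" where
  "radial_measure d \<mu> \<longleftrightarrow>
     sets \<mu> = sets (borel_vec d) \<and>
     (\<forall>A. orthogonal_mat d A \<longrightarrow> distr \<mu> (borel_vec d) (mat_apply d A) = \<mu>)"

text \<open>
  The defining property of \<open>\<nu>\<^sub>d\<close>. For \<open>d \<ge> 1\<close> and a probability measure \<open>\<nu>\<close> on
  \<open>[0,\<infinity>)\<close> it determines \<open>\<mu>\<close> uniquely.
\<close>

definition radial_law_of :: "real measure \<Rightarrow> nat \<Rightarrow> (nat \<Rightarrow> real) measure \<Rightarrow> bool" where
  "radial_law_of \<nu> d \<mu> \<longleftrightarrow>
     prob_space \<mu> \<and> radial_measure d \<mu> \<and> distr \<mu> borel (vec_norm d) = \<nu>"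

text \<open>\<open>N(m, v)\<close>, parametrised by the variance \<open>v \<ge> 0\<close>; the library's \<open>normal_density\<close> takes
  the standard deviation and does not cover the degenerate case.\<close>

definition normal_law :: "real \<Rightarrow> real \<Rightarrow> real measure" where
  "normal_law m v =
     (if v = 0 then return borel m else density lborel (\<lambda>x. ennreal (normal_density m (sqrt v) x)))"

end

theory Submission
  imports Defs
begin

text \<open>
  Expanding the square gives
  \<open>\<parallel>S\<^sub>n\<parallel>\<^sup>2 = (\<Sum>k\<le>n. \<parallel>X\<^sub>k\<parallel>\<^sup>2) + R\<^sub>n\<close>, where \<open>R\<^sub>n\<close> collects the inner products \<open>\<langle>X\<^sub>k, X\<^sub>l\<rangle>\<close> with
  \<open>k \<noteq> l\<close>. The \<open>\<parallel>X\<^sub>k\<parallel>\<^sup>2\<close> are i.i.d. with a law that does not depend on the dimension: the image of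
  \<open>\<nu>\<close> under squaring, with mean \<open>\<sigma>\<^sup>2\<close> and variance \<open>m\<^sub>4 - \<sigma>\<^sup>4\<close>. So the first sum, centred and divided
  by \<open>\<surd>n\<close>, obeys the classical central limit theorem, and it remains to see that \<open>R\<^sub>n / \<surd>n\<close> is
  negligible.

  In high dimension two independent radial vectors are almost orthogonal. Invariance under sign
  changes and permutations of the coordinates forces a radial vector to have mean \<open>0\<close> and covariance
  matrix \<open>(\<sigma>\<^sup>2 / d) I\<close> (\<open>radial_first_moment\<close>, \<open>radial_second_moments\<close>). Hence
  \<open>E \<langle>X\<^sub>k, X\<^sub>l\<rangle>\<^sup>2 = d (\<sigma>\<^sup>2 / d)\<^sup>2 = \<sigma>\<^sup>4 / d\<close>, the cross terms of different pairs \<open>{k, l}\<close> are uncorrelated, and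
  \<open>E R\<^sub>n\<^sup>2 = 2 n (n - 1) \<sigma>\<^sup>4 / d\<close> (\<open>cross_sum_second_moment\<close>). Therefore \<open>R\<^sub>n / \<surd>n\<close> has second moment at
  most \<open>2 \<sigma>\<^sup>4 n / d\<close>, which tends to \<open>0\<close> along \<open>d = p\<^sub>n\<close>.

  The underlying probability space changes with \<open>n\<close>, so the argument is carried out with
  characteristic functions. Adding \<open>R\<^sub>n / \<surd>n\<close> changes the characteristic function at \<open>t\<close> by at most
  \<open>\<bar>t\<bar>\<close> times its \<open>L\<^sup>2\<close> norm (\<open>char_perturbation\<close>). What is left is a power
  \<open>\<phi>(t / \<surd>n)\<^sup>n\<close> for a single fixed \<open>\<phi>\<close>, whose limit is \<open>exp (- v t\<^sup>2 / 2)\<close> with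
  \<open>v = m\<^sub>4 - \<sigma>\<^sup>4\<close> (\<open>char_power_tendsto_normal\<close>). Levy's continuity theorem concludes.
\<close>

section \<open>Characteristic functions\<close>

text \<open>
  For positive variance the law is the image of the standard normal law under scaling by \<open>\<surd>v\<close>. The
  degenerate case obeys the same formula, with characteristic function constantly \<open>1\<close>.
\<close>

lemma
  assumes "0 \<le> v"
  shows real_distribution_normal_law: "real_distribution (normal_law 0 v)"
    and char_normal_law: "char (normal_law 0 v) t = complex_of_real (exp (- (v * t\<^sup>2) / 2))"
proof -
  have "real_distribution (normal_law 0 v) \<and>
    char (normal_law 0 v) t = complex_of_real (exp (- (v * t\<^sup>2) / 2))"
  proof (cases "v = 0")
    case True
    have "prob_space (return borel (0::real))"
      by (rule prob_space_return) simp
    then show ?thesis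
      using True
      by (simp add: normal_law_def real_distribution_def real_distribution_axioms_def char_def
          integral_return)
  next
    case False
    with assms have v: "0 < sqrt v" by simp
    interpret N: real_distribution std_normal_distribution
      by (rule real_dist_normal_dist)
    have "distributed std_normal_distribution lborel (\<lambda>x. x) (normal_density 0 1)"
      unfolding distributed_def by (auto simp: distr_id2)
    from N.normal_density_affine[OF this, of "sqrt v" 0] v
    have "distributed std_normal_distribution lborel (\<lambda>x. sqrt v * x) (normal_density 0 (sqrt v))"
      by simp
    then have "distr std_normal_distribution lborel (\<lambda>x. sqrt v * x) = normal_law 0 v"
      using False by (simp add: distributed_def normal_law_def)
    moreover have "distr std_normal_distribution lborel (\<lambda>x. sqrt v * x)
        = distr std_normal_distribution borel (\<lambda>x. sqrt v * x)"
      by (rule distr_cong) auto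
    ultimately have law: "normal_law 0 v = distr std_normal_distribution borel (\<lambda>x. sqrt v * x)"
      by simp
    have "char (normal_law 0 v) t = char std_normal_distribution (t * sqrt v)"
      unfolding law char_def by (subst integral_distr) (auto simp: ac_simps)
    also have "\<dots> = complex_of_real (exp (- (v * t\<^sup>2) / 2))"
      using assms by (simp add: char_std_normal_distribution power_mult_distrib ac_simps)
    finally show ?thesis
      unfolding law by (auto intro!: N.real_distribution_distr)
  qed
  then show "real_distribution (normal_law 0 v)"
    and "char (normal_law 0 v) t = complex_of_real (exp (- (v * t\<^sup>2) / 2))"
    by auto
qed

text \<open>
  This is the analytic core of the central limit theorem for i.i.d. variables, phrased for a power of
  one characteristic function, so that no common probability space is involved. Dividing by
  \<open>\<surd>n\<close> alone, and not by the standard deviation, allows \<open>v = 0\<close>. The second-order expansion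
  \<open>\<phi>(u) \<approx> 1 - v u\<^sup>2 / 2\<close> at \<open>u = t / \<surd>n\<close> has an error that stays \<open>o(1 / n)\<close> by dominated
  convergence, so taking \<open>n\<close>-th powers costs only \<open>o(1)\<close>.
\<close>

lemma (in real_distribution) char_power_tendsto_normal:
  assumes int1: "integrable M (\<lambda>x. x)" and mean: "expectation (\<lambda>x. x) = 0"
    and int2: "integrable M (\<lambda>x. x\<^sup>2)" and var: "expectation (\<lambda>x. x\<^sup>2) = v"
  shows "(\<lambda>n. char M (t / sqrt (real n)) ^ n) \<longlonglongrightarrow> complex_of_real (exp (- (v * t\<^sup>2) / 2))"
proof -
  define u where "u n = t / sqrt (real n)" for n
  define E where "E n = expectation (\<lambda>x. min (6 * x\<^sup>2) (\<bar>u n\<bar> * \<bar>x\<bar> ^ 3))" for n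
  have v0: "0 \<le> v" unfolding var[symmetric] by simp
  have u_lim: "u \<longlonglongrightarrow> 0"
    unfolding u_def
    by (intro tendsto_divide_0[OF tendsto_const] filterlim_at_top_imp_at_infinity
        sqrt_at_top[THEN filterlim_compose] filterlim_real_sequentially)
  have "E \<longlonglongrightarrow> expectation (\<lambda>x. 0)"
    unfolding E_def
  proof (rule integral_dominated_convergence[where w = "\<lambda>x. 6 * x\<^sup>2"])
    have "(\<lambda>n. min (6 * x\<^sup>2) (\<bar>u n\<bar> * \<bar>x\<bar> ^ 3)) \<longlonglongrightarrow> min (6 * x\<^sup>2) (\<bar>0\<bar> * \<bar>x\<bar> ^ 3)" for x
      by (intro tendsto_intros u_lim)
    then show "AE x in M. (\<lambda>n. min (6 * x\<^sup>2) (\<bar>u n\<bar> * \<bar>x\<bar> ^ 3)) \<longlonglongrightarrow> 0"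
      by (simp add: min_absorb2)
  qed (use int2 in auto)
  then have bound_lim: "(\<lambda>n. t\<^sup>2 / 6 * E n) \<longlonglongrightarrow> 0"
    by (simp add: tendsto_mult_right_zero)
  have close: "\<forall>\<^sub>F n in sequentially.
      norm (char M (u n) ^ n - (1 + (- (v * t\<^sup>2) / 2) / n) ^ n) \<le> t\<^sup>2 / 6 * E n"
  proof (rule eventually_sequentiallyI)
    fix n :: nat
    \<comment> \<open>For such \<open>n\<close> the Taylor polynomial lies in \<open>[-1, 1]\<close>, so that \<open>\<bar>a\<^sup>n - b\<^sup>n\<bar> \<le> n \<bar>a - b\<bar>\<close> applies.\<close>
    assume "n \<ge> max 1 (nat \<lceil>v * t\<^sup>2 / 4\<rceil>)"
    then have n: "n \<ge> 1" "real n \<ge> v * t\<^sup>2 / 4"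
      by (auto simp: nat_ceiling_le_eq)
    have u2: "(u n)\<^sup>2 = t\<^sup>2 / n" by (simp add: u_def power_divide)
    define w :: real where "w = 1 + (- (v * t\<^sup>2) / 2) / n"
    have w: "norm (complex_of_real w) \<le> 1"
    proof -
      have "v * t\<^sup>2 / (4 * real n) \<le> 1" using n by (simp add: field_simps)
      moreover have "0 \<le> v * t\<^sup>2 / (4 * real n)" using v0 by simp
      moreover have "w = 1 - 2 * (v * t\<^sup>2 / (4 * real n))" by (simp add: w_def)
      ultimately have "\<bar>w\<bar> \<le> 1" by linarith
      then show ?thesis by simp
    qed
    have "norm (char M (u n) - (1 - (u n)\<^sup>2 * v / 2)) \<le> (u n)\<^sup>2 / 6 * E n"
      unfolding E_def using assms by (intro char_approx3) auto
    then have *: "norm (char M (u n) - w) \<le> (u n)\<^sup>2 / 6 * E n"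
      by (simp add: u2 w_def mult.commute)
    have "norm (char M (u n) ^ n - complex_of_real w ^ n) \<le> n * norm (char M (u n) - w)"
      using w by (intro norm_power_diff cmod_char_le_1)
    also have "\<dots> \<le> n * ((u n)\<^sup>2 / 6 * E n)"
      by (intro mult_left_mono *) simp
    also have "\<dots> = t\<^sup>2 / 6 * E n" using n by (simp add: u2)
    finally show "norm (char M (u n) ^ n - (1 + (- (v * t\<^sup>2) / 2) / n) ^ n) \<le> t\<^sup>2 / 6 * E n"
      by (simp add: w_def)
  qed
  have "(\<lambda>n. complex_of_real ((1 + (- (v * t\<^sup>2) / 2) / n) ^ n))
      \<longlonglongrightarrow> complex_of_real (exp (- (v * t\<^sup>2) / 2))"
    by (intro tendsto_of_real tendsto_exp_limit_sequentially)
  then have "(\<lambda>n. char M (u n) ^ n) \<longlonglongrightarrow> complex_of_real (exp (- (v * t\<^sup>2) / 2))"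
    by (rule Lim_transform) (rule Lim_null_comparison[OF _ bound_lim], use close in simp)
  then show ?thesis by (simp add: u_def)
qed

text \<open>
  Nonnegativity of the variance of \<open>\<bar>R\<bar>\<close>.
\<close>

lemma (in prob_space) expectation_abs_le_sqrt:
  fixes R :: "'a \<Rightarrow> real"
  assumes [measurable]: "random_variable borel R" and int: "integrable M (\<lambda>x. (R x)\<^sup>2)"
  shows "expectation (\<lambda>x. \<bar>R x\<bar>) \<le> sqrt (expectation (\<lambda>x. (R x)\<^sup>2))"
proof (rule real_le_rsqrt)
  have "integrable M R"
    by (rule square_integrable_imp_integrable) (use int in auto)
  then have "variance (\<lambda>x. \<bar>R x\<bar>) = expectation (\<lambda>x. (R x)\<^sup>2) - (expectation (\<lambda>x. \<bar>R x\<bar>))\<^sup>2"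
    using int by (subst variance_eq) auto
  then show "(expectation (\<lambda>x. \<bar>R x\<bar>))\<^sup>2 \<le> expectation (\<lambda>x. (R x)\<^sup>2)"
    using variance_positive[of "\<lambda>x. \<bar>R x\<bar>"] by linarith
qed

text \<open>
  The map \<open>x \<mapsto> exp (\<i> t x)\<close> is \<open>\<bar>t\<bar>\<close>-Lipschitz, so the difference is at most \<open>\<bar>t\<bar> E\<bar>R\<bar>\<close>.
\<close>

lemma (in prob_space) char_perturbation:
  fixes Z R :: "'a \<Rightarrow> real"
  assumes [measurable]: "random_variable borel Z" "random_variable borel R"
    and int: "integrable M (\<lambda>x. (R x)\<^sup>2)"
  shows "norm (char (distr M borel (\<lambda>x. Z x + R x)) t - char (distr M borel Z) t)
    \<le> \<bar>t\<bar> * sqrt (expectation (\<lambda>x. (R x)\<^sup>2))"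
proof -
  have intR: "integrable M R"
    by (rule square_integrable_imp_integrable) (use int in auto)
  have iexp_int: "integrable M (\<lambda>x. iexp (t * f x))" if [measurable]: "random_variable borel f" for f
    by (rule integrable_iexp) auto
  have pointwise: "norm (iexp (t * (Z x + R x)) - iexp (t * Z x)) \<le> \<bar>t\<bar> * \<bar>R x\<bar>" for x
  proof -
    have "iexp (t * (Z x + R x)) - iexp (t * Z x) = iexp (t * Z x) * (iexp (t * R x) - 1)"
      by (simp add: algebra_simps exp_add)
    then have "norm (iexp (t * (Z x + R x)) - iexp (t * Z x)) = norm (iexp (t * R x) - 1)"
      by (simp add: norm_mult)
    also have "\<dots> \<le> \<bar>t * R x\<bar>" using iexp_approx1[of "t * R x" 0] by simp
    finally show ?thesis by (simp add: abs_mult)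
  qed
  have "char (distr M borel (\<lambda>x. Z x + R x)) t - char (distr M borel Z) t
      = expectation (\<lambda>x. iexp (t * (Z x + R x)) - iexp (t * Z x))"
    unfolding char_def
    by (subst (1 2) integral_distr, simp_all del: of_real_mult of_real_add,
        subst Bochner_Integration.integral_diff)
      (auto intro!: iexp_int simp del: of_real_mult of_real_add)
  also have "norm \<dots> \<le> expectation (\<lambda>x. norm (iexp (t * (Z x + R x)) - iexp (t * Z x)))"
    by (rule integral_norm_bound)
  also have "\<dots> \<le> expectation (\<lambda>x. \<bar>t\<bar> * \<bar>R x\<bar>)"
    by (rule integral_mono)
      (use intR pointwise in \<open>auto intro!: integrable_norm iexp_int simp del: of_real_mult of_real_add\<close>)
  also have "\<dots> = \<bar>t\<bar> * expectation (\<lambda>x. \<bar>R x\<bar>)" by simp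
  also have "\<dots> \<le> \<bar>t\<bar> * sqrt (expectation (\<lambda>x. (R x)\<^sup>2))"
    by (intro mult_left_mono expectation_abs_le_sqrt int) auto
  finally show ?thesis .
qed

section \<open>Moments of radial measures\<close>

lemma measurable_borel_vec_component:
  "i < d \<Longrightarrow> f \<in> measurable N (borel_vec d) \<Longrightarrow> (\<lambda>x. f x i) \<in> borel_measurable N"
  unfolding borel_vec_def
  by (rule measurable_compose[OF _ measurable_component_singleton]) auto

lemma borel_vec_component: "i < d \<Longrightarrow> (\<lambda>x. x i) \<in> borel_measurable (borel_vec d)"
  by (rule measurable_borel_vec_component) auto

lemma vec_norm_square: "(vec_norm d x)\<^sup>2 = (\<Sum>i<d. (x i)\<^sup>2)"
  by (simp add: vec_norm_def L2_set_def sum_nonneg)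

lemma vec_norm_measurable [measurable]: "vec_norm d \<in> borel_measurable (borel_vec d)"
proof -
  have "(\<lambda>x. sqrt (\<Sum>i<d. (x i)\<^sup>2)) \<in> borel_measurable (borel_vec d)"
  proof -
    have [measurable]: "(\<lambda>x. \<Sum>i<d. (x i)\<^sup>2 :: real) \<in> borel_measurable (borel_vec d)"
      by (intro borel_measurable_sum borel_measurable_power borel_vec_component) auto
    show ?thesis by measurable
  qed
  then show ?thesis by (simp add: vec_norm_def[abs_def] L2_set_def)
qed

text \<open>
  Signed permutations are a finite family of orthogonal maps, yet invariance under them already
  determines the covariance matrix up to a scalar. Handling signs and permutations in one family means
  that the invariance has to be unfolded only once.
\<close>

lemma orthogonal_signed_permutation:
  assumes \<pi>: "\<pi> permutes {..<d}" and s: "\<And>k. (s k)\<^sup>2 = 1"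
  shows "orthogonal_mat d (\<lambda>k l. if l = \<pi> k then s k else 0)"
  unfolding orthogonal_mat_def
proof (intro allI impI)
  fix i j assume ij: "i < d" "j < d"
  have s1: "s k * s k = 1" for k using s[of k] by (simp add: power2_eq_square)
  have "(\<Sum>k<d. (if i = \<pi> k then s k else 0) * (if j = \<pi> k then s k else 0))
      = (\<Sum>k<d. (\<lambda>m. if m = i then if i = j then 1 else 0 else 0) (\<pi> k))"
    by (intro sum.cong) (auto simp: s1)
  also have "\<dots> = (\<Sum>m<d. if m = i then if i = j then 1 else 0 else 0)"
    by (rule sum.permute[OF \<pi>, unfolded comp_def, symmetric])
  also have "\<dots> = (if i = j then 1 else 0)" using ij by simp
  finally show "(\<Sum>k<d. (if i = \<pi> k then s k else 0) * (if j = \<pi> k then s k else 0))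
      = (if i = j then 1 else (0::real))" .
qed

lemma integral_radial_signed_permutation:
  fixes s :: "nat \<Rightarrow> real" and f :: "(nat \<Rightarrow> real) \<Rightarrow> real"
  assumes rad: "radial_measure d \<mu>" and \<pi>: "\<pi> permutes {..<d}" and s: "\<And>k. (s k)\<^sup>2 = 1"
    and f: "f \<in> borel_measurable (borel_vec d)"
  shows "(\<integral>x. f (\<lambda>k\<in>{..<d}. s k * x (\<pi> k)) \<partial>\<mu>) = (\<integral>x. f x \<partial>\<mu>)"
proof -
  let ?A = "\<lambda>k l. if l = \<pi> k then s k else 0"
  have sets: "sets \<mu> = sets (borel_vec d)" using rad by (simp add: radial_measure_def)
  have apply_eq: "mat_apply d ?A = (\<lambda>x. \<lambda>k\<in>{..<d}. s k * x (\<pi> k))"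
  proof (intro ext)
    fix x k
    have "(\<Sum>j<d. (if j = \<pi> k then s k else 0) * x j) = s k * x (\<pi> k)" if "k < d"
    proof -
      have "\<pi> k < d" using permutes_in_image[OF \<pi>, of k] that by simp
      then show ?thesis by (simp add: if_distrib[of "\<lambda>z. z * _"] cong: if_cong)
    qed
    then show "mat_apply d ?A x k = (\<lambda>k\<in>{..<d}. s k * x (\<pi> k)) k"
      by (simp add: mat_apply_def restrict_def)
  qed
  have "mat_apply d ?A \<in> measurable (borel_vec d) (borel_vec d)"
  proof -
    have "(\<lambda>x. \<lambda>k\<in>{..<d}. s k * x (\<pi> k)) \<in> measurable (borel_vec d) (PiM {..<d} (\<lambda>_. borel))"
    proof (rule measurable_restrict)
      fix k assume "k \<in> {..<d}"
      then have "\<pi> k < d" using permutes_in_image[OF \<pi>, of k] by simp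
      from borel_vec_component[OF this]
      show "(\<lambda>x. s k * x (\<pi> k)) \<in> borel_measurable (borel_vec d)" by measurable
    qed
    then show ?thesis unfolding apply_eq by (simp add: borel_vec_def)
  qed
  then have meas: "mat_apply d ?A \<in> measurable \<mu> (borel_vec d)"
    using measurable_cong_sets[OF sets refl] by blast
  have "(\<integral>x. f x \<partial>\<mu>) = (\<integral>x. f x \<partial>distr \<mu> (borel_vec d) (mat_apply d ?A))"
    using rad orthogonal_signed_permutation[OF \<pi> s] by (simp add: radial_measure_def)
  also have "\<dots> = (\<integral>x. f (mat_apply d ?A x) \<partial>\<mu>)"
    by (rule integral_distr[OF meas f])
  finally show ?thesis by (simp add: apply_eq)
qed

lemma abs_mult_le_sum_squares: "\<bar>a * b\<bar> \<le> a\<^sup>2 + (b::real)\<^sup>2"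
proof -
  have "0 \<le> (\<bar>a\<bar> - \<bar>b\<bar>)\<^sup>2" "0 \<le> \<bar>a\<bar> * \<bar>b\<bar>" by simp_all
  then show ?thesis unfolding power2_diff abs_mult power2_abs by linarith
qed

lemma integrable_mult_of_squares:
  fixes f g :: "'a \<Rightarrow> real"
  assumes [measurable]: "f \<in> borel_measurable M" "g \<in> borel_measurable M"
    and "integrable M (\<lambda>x. (f x)\<^sup>2)" "integrable M (\<lambda>x. (g x)\<^sup>2)"
  shows "integrable M (\<lambda>x. f x * g x)"
proof (rule Bochner_Integration.integrable_bound)
  show "integrable M (\<lambda>x. (f x)\<^sup>2 + (g x)\<^sup>2)" using assms by simp
  show "AE x in M. norm (f x * g x) \<le> norm ((f x)\<^sup>2 + (g x)\<^sup>2)"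
    using abs_mult_le_sum_squares by (auto intro!: AE_I2)
qed measurable

text \<open>
  Flipping the sign of coordinate \<open>i\<close> negates \<open>x\<^sub>i\<close> and \<open>x\<^sub>i x\<^sub>j\<close> for \<open>j \<noteq> i\<close>, so these have integral \<open>0\<close>.
  Transposing two coordinates shows that all \<open>x\<^sub>i\<^sup>2\<close> have the same integral, and these integrals add up
  to that of \<open>\<parallel>x\<parallel>\<^sup>2\<close>.
\<close>

lemma
  assumes prob: "prob_space \<mu>" and rad: "radial_measure d \<mu>"
    and int: "integrable \<mu> (\<lambda>x. (vec_norm d x)\<^sup>2)" and i: "i < d"
  shows radial_first_moment: "has_bochner_integral \<mu> (\<lambda>x. x i) 0"
    and radial_second_moments: "j < d \<Longrightarrow> has_bochner_integral \<mu> (\<lambda>x. x i * x j)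
      (if i = j then (\<integral>x. (vec_norm d x)\<^sup>2 \<partial>\<mu>) / d else 0)"
proof -
  interpret prob_space \<mu> by fact
  have sets[measurable_cong]: "sets \<mu> = sets (borel_vec d)"
    using rad by (simp add: radial_measure_def)
  have comp_meas[measurable]: "(\<lambda>x. x k) \<in> borel_measurable (borel_vec d)" if "k < d" for k
    using that by (rule borel_vec_component)
  have comp_meas': "(\<lambda>x. x k) \<in> borel_measurable \<mu>" if "k < d" for k
    using that by measurable
  have sq_int: "integrable \<mu> (\<lambda>x. (x k)\<^sup>2)" if "k < d" for k
  proof (rule Bochner_Integration.integrable_bound[OF int])
    show "(\<lambda>x. (x k)\<^sup>2) \<in> borel_measurable \<mu>" using that by measurable
    have "(x k)\<^sup>2 \<le> (\<Sum>l<d. (x l)\<^sup>2)" for x :: "nat \<Rightarrow> real"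
      using that by (intro member_le_sum) auto
    then show "AE x in \<mu>. norm ((x k)\<^sup>2) \<le> norm ((vec_norm d x)\<^sup>2)"
      by (simp add: vec_norm_square sum_nonneg)
  qed
  have lin_int: "integrable \<mu> (\<lambda>x. x i)"
    by (rule square_integrable_imp_integrable[OF comp_meas'[OF i] sq_int[OF i]])
  define s where "s k = (if k = i then -1 else 1::real)" for k
  have s2: "(s k)\<^sup>2 = 1" for k by (simp add: s_def)
  have "(\<integral>x. x i \<partial>\<mu>) = (\<integral>x. - x i \<partial>\<mu>)"
    using integral_radial_signed_permutation[where s = s, OF rad permutes_id s2 comp_meas[OF i]] i
    by (simp add: s_def)
  then show "has_bochner_integral \<mu> (\<lambda>x. x i) 0"
    using lin_int by (simp add: has_bochner_integral_iff)
  show "has_bochner_integral \<mu> (\<lambda>x. x i * x j)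
      (if i = j then (\<integral>x. (vec_norm d x)\<^sup>2 \<partial>\<mu>) / d else 0)" if j: "j < d"
  proof (cases "i = j")
    case False
    have "(\<lambda>x. x i * x j) \<in> borel_measurable (borel_vec d)" using i j by measurable
    from integral_radial_signed_permutation[where s = s, OF rad permutes_id s2 this]
    have "(\<integral>x. x i * x j \<partial>\<mu>) = (\<integral>x. - (x i * x j) \<partial>\<mu>)"
      using i j False by (simp add: s_def)
    then show ?thesis
      using False integrable_mult_of_squares[OF comp_meas'[OF i] comp_meas'[OF j] sq_int[OF i] sq_int[OF j]]
      by (simp add: has_bochner_integral_iff)
  next
    case True
    have swap: "(\<integral>x. (x k)\<^sup>2 \<partial>\<mu>) = (\<integral>x. (x i)\<^sup>2 \<partial>\<mu>)" if k: "k < d" for k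
    proof -
      have \<pi>: "Transposition.transpose i k permutes {..<d}"
        using i k by (intro permutes_swap_id) auto
      have "(\<lambda>x. (x i)\<^sup>2) \<in> borel_measurable (borel_vec d)" using i by measurable
      from integral_radial_signed_permutation[OF rad \<pi> _ this, of "\<lambda>_. 1"]
      show ?thesis using i by simp
    qed
    have "(\<integral>x. (vec_norm d x)\<^sup>2 \<partial>\<mu>) = (\<Sum>k<d. \<integral>x. (x k)\<^sup>2 \<partial>\<mu>)"
      unfolding vec_norm_square using sq_int by (intro Bochner_Integration.integral_sum) auto
    also have "\<dots> = d * (\<integral>x. (x i)\<^sup>2 \<partial>\<mu>)" using swap by simp
    finally have "(\<integral>x. (x i)\<^sup>2 \<partial>\<mu>) = (\<integral>x. (vec_norm d x)\<^sup>2 \<partial>\<mu>) / d" using i by simp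
    then show ?thesis
      using True sq_int[OF i] by (simp add: has_bochner_integral_iff power2_eq_square)
  qed
qed

section \<open>Cross terms of independent isotropic vectors\<close>

lemma has_bochner_integral_distrD:
  fixes f :: "'b \<Rightarrow> real"
  assumes "has_bochner_integral (distr M N g) f a"
    and "f \<in> borel_measurable N" "g \<in> measurable M N"
  shows "has_bochner_integral M (\<lambda>x. f (g x)) a"
  using assms by (simp add: has_bochner_integral_iff integrable_distr_eq integral_distr)

lemma (in prob_space) has_bochner_integral_indep_mult:
  fixes f g :: "'a \<Rightarrow> real"
  assumes "indep_var borel f borel g" "has_bochner_integral M f a" "has_bochner_integral M g b"
  shows "has_bochner_integral M (\<lambda>x. f x * g x) (a * b)"
  using assms indep_var_lebesgue_integral[of f g] indep_var_integrable[of f g]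
  by (simp add: has_bochner_integral_iff)

text \<open>
  The form in which independence enters the induction on the number of vectors: a statistic of the
  first \<open>n\<close> of them against a statistic of the next one.
\<close>

lemma (in prob_space) indep_var_past_future:
  assumes ind: "indep_vars (\<lambda>k. N) X {1..}"
    and f: "f \<in> measurable (PiM {1..n} (\<lambda>_. N)) N1" and g: "g \<in> measurable N N2"
  shows "indep_var N1 (\<lambda>\<omega>. f (\<lambda>k\<in>{1..n}. X k \<omega>)) N2 (\<lambda>\<omega>. g (X (Suc n) \<omega>))"
proof -
  have "indep_var (PiM {1..n} (\<lambda>_. N)) (\<lambda>\<omega>. \<lambda>k\<in>{1..n}. X k \<omega>)
      (PiM {Suc n} (\<lambda>_. N)) (\<lambda>\<omega>. \<lambda>k\<in>{Suc n}. X k \<omega>)"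
    by (rule indep_var_restrict[OF ind]) auto
  moreover have "(\<lambda>h. g (h (Suc n))) \<in> measurable (PiM {Suc n} (\<lambda>_. N)) N2"
    using measurable_component_singleton[of "Suc n" "{Suc n}" "\<lambda>_. N"]
    by (intro measurable_compose[OF _ g]) simp
  ultimately have "indep_var N1 (f \<circ> (\<lambda>\<omega>. \<lambda>k\<in>{1..n}. X k \<omega>))
      N2 ((\<lambda>h. g (h (Suc n))) \<circ> (\<lambda>\<omega>. \<lambda>k\<in>{Suc n}. X k \<omega>))"
    by (rule indep_var_compose[OF _ f])
  then show ?thesis by (simp add: comp_def)
qed

text \<open>
  This is \<open>\<Sum>k\<noteq>l. \<langle>x\<^sub>k, x\<^sub>l\<rangle>\<close> over \<open>k, l \<in> {1..n}\<close>. Writing it as \<open>\<parallel>\<Sum>x\<^sub>k\<parallel>\<^sup>2 - \<Sum>\<parallel>x\<^sub>k\<parallel>\<^sup>2\<close> avoids a double sum over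
  pairs and gives the recursion below.
\<close>

definition cross_sum :: "nat \<Rightarrow> (nat \<Rightarrow> nat \<Rightarrow> real) \<Rightarrow> nat \<Rightarrow> real" where
  "cross_sum d x n = (\<Sum>i<d. (\<Sum>k\<in>{1..n}. x k i)\<^sup>2) - (\<Sum>k\<in>{1..n}. \<Sum>i<d. (x k i)\<^sup>2)"

lemma cross_sum_Suc:
  "cross_sum d x (Suc n) = cross_sum d x n + 2 * (\<Sum>i<d. (\<Sum>k\<in>{1..n}. x k i) * x (Suc n) i)"
  by (simp add: cross_sum_def power2_sum sum.distrib sum_distrib_left algebra_simps)

text \<open>
  Write \<open>S\<close> and \<open>R\<close> for the sum and the cross terms of the first \<open>n\<close> vectors and \<open>x\<close> for the next
  vector. The new cross terms are \<open>R + 2 \<langle>S, x\<rangle>\<close>. Since \<open>x\<close> is centred and independent of \<open>(R, S)\<close>, the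
  mixed term \<open>E (R \<langle>S, x\<rangle>)\<close> vanishes. The covariance matrix of \<open>S\<close> is \<open>n c I\<close> and that of \<open>x\<close> is \<open>c I\<close>, so
  \<open>E \<langle>S, x\<rangle>\<^sup>2 = n c\<^sup>2 d\<close>. Each step thus adds \<open>4 n c\<^sup>2 d\<close>, and these increments sum to
  \<open>2 n (n - 1) c\<^sup>2 d\<close>.
\<close>

lemma (in prob_space) cross_sum_second_moment:
  assumes ind: "indep_vars (\<lambda>k. borel_vec d) X {1..}"
    and mean: "\<And>k i. 1 \<le> k \<Longrightarrow> i < d \<Longrightarrow> has_bochner_integral M (\<lambda>\<omega>. X k \<omega> i) 0"
    and cov: "\<And>k i j. 1 \<le> k \<Longrightarrow> i < d \<Longrightarrow> j < d \<Longrightarrow>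
      has_bochner_integral M (\<lambda>\<omega>. X k \<omega> i * X k \<omega> j) (if i = j then c else 0)"
  shows "has_bochner_integral M (\<lambda>\<omega>. (cross_sum d (\<lambda>k. X k \<omega>) n)\<^sup>2)
    (2 * real n * (real n - 1) * c\<^sup>2 * real d)"
proof -
  define S where "S n i \<omega> = (\<Sum>k\<in>{1..n}. X k \<omega> i)" for n i \<omega>
  define R where "R n \<omega> = cross_sum d (\<lambda>k. X k \<omega>) n" for n \<omega>
  have X_meas: "X k \<in> measurable M (borel_vec d)" if "1 \<le> k" for k
    using ind that by (auto simp: indep_vars_def)
  have Xi_meas [measurable]: "(\<lambda>\<omega>. X k \<omega> i) \<in> borel_measurable M" if "1 \<le> k" "i < d" for k i
    using measurable_borel_vec_component[OF that(2) X_meas[OF that(1)]] .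
  have S_meas [measurable]: "S n i \<in> borel_measurable M" if "i < d" for n i
    unfolding S_def using that by (intro borel_measurable_sum Xi_meas) auto
  have R_eq: "R n \<omega> = (\<Sum>i<d. (S n i \<omega>)\<^sup>2) - (\<Sum>k\<in>{1..n}. \<Sum>i<d. (X k \<omega> i)\<^sup>2)" for n \<omega>
    by (simp add: R_def S_def cross_sum_def)
  have R_meas [measurable]: "R n \<in> borel_measurable M" for n
    unfolding R_eq
    by (intro borel_measurable_diff borel_measurable_sum borel_measurable_power S_meas Xi_meas) auto

  \<comment> \<open>\<open>S n\<close> and \<open>R n\<close> are functions of the first \<open>n\<close> vectors, hence independent of the next one.\<close>
  let ?P = "\<lambda>n. PiM {1..n} (\<lambda>_. borel_vec d)"
  let ?S = "\<lambda>n i h. \<Sum>k\<in>{1..n}. h k i :: real"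
  have comp: "(\<lambda>h. h k i) \<in> borel_measurable (?P n)" if "k \<in> {1..n}" "i < d" for n k i
    by (rule measurable_borel_vec_component[OF that(2)])
      (rule measurable_component_singleton[OF that(1)])
  have S_past: "?S n i \<in> borel_measurable (?P n)" if "i < d" for n i
    using that by (intro borel_measurable_sum comp) auto
  have R_past: "(\<lambda>h. cross_sum d h n) \<in> borel_measurable (?P n)" for n
    unfolding cross_sum_def
    by (intro borel_measurable_diff borel_measurable_sum borel_measurable_power comp) auto
  have S_restrict: "?S n i (\<lambda>k\<in>{1..n}. X k \<omega>) = S n i \<omega>" for n i \<omega>
    by (simp add: S_def)
  have R_restrict: "cross_sum d (\<lambda>k\<in>{1..n}. X k \<omega>) n = R n \<omega>" for n \<omega>
    by (simp add: R_def cross_sum_def)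
  have coord: "(\<lambda>x. x i) \<in> borel_measurable (borel_vec d)" if "i < d" for i
    using that by (rule borel_vec_component)
  have coord2: "(\<lambda>x. x i * x j) \<in> borel_measurable (borel_vec d)" if "i < d" "j < d" for i j
    using that by (intro borel_measurable_times borel_vec_component)
  have ind_S: "indep_var borel (S n i) borel (\<lambda>\<omega>. X (Suc n) \<omega> j)" if "i < d" "j < d" for n i j
    using indep_var_past_future[OF ind S_past[OF that(1)] coord[OF that(2)]]
    by (simp only: S_restrict)
  have ind_RS: "indep_var borel (\<lambda>\<omega>. R n \<omega> * S n i \<omega>) borel (\<lambda>\<omega>. X (Suc n) \<omega> j)"
    if "i < d" "j < d" for n i j
    using indep_var_past_future[OF ind borel_measurable_times[OF R_past S_past[OF that(1)]]
        coord[OF that(2)]]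
    by (simp only: S_restrict R_restrict)
  have ind_SS: "indep_var borel (\<lambda>\<omega>. S n i \<omega> * S n j \<omega>) borel (\<lambda>\<omega>. X (Suc n) \<omega> i * X (Suc n) \<omega> j)"
    if "i < d" "j < d" for n i j
    using indep_var_past_future[OF ind borel_measurable_times[OF S_past[OF that(1)] S_past[OF that(2)]]
        coord2[OF that]]
    by (simp only: S_restrict)

  have SS: "has_bochner_integral M (\<lambda>\<omega>. S n i \<omega> * S n j \<omega>) (if i = j then n * c else 0)"
    if "i < d" "j < d" for n i j
    using that
  proof (induction n arbitrary: i j)
    case 0
    then show ?case by (auto simp: S_def has_bochner_integral_zero)
  next
    case (Suc n)
    let ?x = "\<lambda>i \<omega>. X (Suc n) \<omega> i"
    have int_S: "integrable M (S n i)" if "i < d" for i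
      by (rule square_integrable_imp_integrable)
        (use Suc.IH[OF that that] that in \<open>auto simp: has_bochner_integral_iff power2_eq_square\<close>)
    have cross: "has_bochner_integral M (\<lambda>\<omega>. S n i \<omega> * ?x j \<omega>) 0" if "i < d" "j < d" for i j
      using has_bochner_integral_indep_mult[OF ind_S[OF that]
          has_bochner_integral_integrable[OF int_S[OF that(1)]] mean[of "Suc n" j]] that
      by simp
    have "has_bochner_integral M (\<lambda>\<omega>. (S n i \<omega> * S n j \<omega> + S n i \<omega> * ?x j \<omega>)
        + (S n j \<omega> * ?x i \<omega> + ?x i \<omega> * ?x j \<omega>))
        (((if i = j then n * c else 0) + 0) + (0 + (if i = j then c else 0)))"
      using Suc.prems by (intro has_bochner_integral_add Suc.IH cross cov) auto
    moreover have "S (Suc n) i \<omega> = S n i \<omega> + ?x i \<omega>" for i \<omega>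
      by (simp add: S_def)
    ultimately show ?case by (simp add: algebra_simps split: if_splits)
  qed
  have S_sq: "integrable M (\<lambda>\<omega>. (S n i \<omega>)\<^sup>2)" if "i < d" for n i
    using SS[OF that that, of n] by (simp add: has_bochner_integral_iff power2_eq_square)

  have "has_bochner_integral M (\<lambda>\<omega>. (R n \<omega>)\<^sup>2) (2 * real n * (real n - 1) * c\<^sup>2 * real d)"
  proof (induction n)
    case 0
    then show ?case by (simp add: R_def cross_sum_def has_bochner_integral_zero)
  next
    case (Suc n)
    let ?x = "\<lambda>i \<omega>. X (Suc n) \<omega> i"
    have RS: "integrable M (\<lambda>\<omega>. R n \<omega> * S n i \<omega>)" if "i < d" for i
      using Suc.IH that
      by (intro integrable_mult_of_squares S_sq S_meas R_meas) (auto simp: has_bochner_integral_iff)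
    have 1: "has_bochner_integral M (\<lambda>\<omega>. (R n \<omega> * S n i \<omega>) * ?x i \<omega>) 0" if "i < d" for i
      using has_bochner_integral_indep_mult[OF ind_RS[OF that that]
          has_bochner_integral_integrable[OF RS[OF that]] mean[of "Suc n" i]] that
      by simp
    have 2: "has_bochner_integral M (\<lambda>\<omega>. (S n i \<omega> * S n j \<omega>) * (?x i \<omega> * ?x j \<omega>))
        (if i = j then n * c\<^sup>2 else 0)" if "i < d" "j < d" for i j
      using has_bochner_integral_indep_mult[OF ind_SS[OF that] SS[OF that] cov[of "Suc n" i j]] that
      by (simp add: power2_eq_square mult.assoc split: if_splits)
    have "has_bochner_integral M (\<lambda>\<omega>. (R n \<omega>)\<^sup>2 + (4 * (\<Sum>i<d. (R n \<omega> * S n i \<omega>) * ?x i \<omega>)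
          + 4 * (\<Sum>i<d. \<Sum>j<d. (S n i \<omega> * S n j \<omega>) * (?x i \<omega> * ?x j \<omega>))))
        (2 * real n * (real n - 1) * c\<^sup>2 * real d
          + (4 * (\<Sum>i<d. 0) + 4 * (\<Sum>i<d. \<Sum>j<d. if i = j then n * c\<^sup>2 else 0)))"
      using 1 2
      by (intro has_bochner_integral_add has_bochner_integral_mult_right has_bochner_integral_sum
          Suc.IH) auto
    moreover have "(R (Suc n) \<omega>)\<^sup>2 = (R n \<omega>)\<^sup>2 + (4 * (\<Sum>i<d. (R n \<omega> * S n i \<omega>) * ?x i \<omega>)
          + 4 * (\<Sum>i<d. \<Sum>j<d. (S n i \<omega> * S n j \<omega>) * (?x i \<omega> * ?x j \<omega>)))" for \<omega>
    proof -
      define T where "T = (\<Sum>i<d. S n i \<omega> * ?x i \<omega>)"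
      have "R (Suc n) \<omega> = R n \<omega> + 2 * T"
        by (simp add: R_def T_def S_def cross_sum_Suc)
      moreover have "(\<Sum>i<d. (R n \<omega> * S n i \<omega>) * ?x i \<omega>) = R n \<omega> * T"
        by (simp add: T_def sum_distrib_left mult.assoc)
      moreover have "(\<Sum>i<d. \<Sum>j<d. (S n i \<omega> * S n j \<omega>) * (?x i \<omega> * ?x j \<omega>)) = T * T"
        by (simp add: T_def sum_product ac_simps)
      ultimately show ?thesis by (simp add: power2_eq_square algebra_simps)
    qed
    moreover have "2 * real n * (real n - 1) * c\<^sup>2 * real d
          + (4 * (\<Sum>i<d. 0) + 4 * (\<Sum>i<d. \<Sum>j<d. if i = j then n * c\<^sup>2 else 0))
        = 2 * real (Suc n) * (real (Suc n) - 1) * c\<^sup>2 * real d"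
      by (simp add: algebra_simps)
    ultimately show ?case by simp
  qed
  then show ?thesis by (simp add: R_def)
qed

section \<open>The limit theorem\<close>

text \<open>
  The quantitative form of the theorem for one dimension \<open>d\<close> and one \<open>n\<close>. The normalised sum splits into
  \<open>\<Sum>Z\<^sub>k\<close>, with i.i.d. \<open>Z\<^sub>k = (\<parallel>X\<^sub>k\<parallel>\<^sup>2 - \<sigma>\<^sup>2) / \<surd>n\<close> whose characteristic functions multiply, and the scaled
  cross terms, which are a small perturbation in \<open>L\<^sup>2\<close>. The crude estimate \<open>n - 1 \<le> n\<^sup>2\<close> puts the bound
  in terms of \<open>n\<^sup>2 / d\<close>, the quantity that tends to \<open>0\<close>.
\<close>

lemma (in prob_space) char_radial_walk_approx:
  fixes X :: "nat \<Rightarrow> 'a \<Rightarrow> nat \<Rightarrow> real"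
  assumes d: "1 \<le> d" and n: "1 \<le> n"
    and law: "radial_law_of \<nu> d \<mu>" and sq: "integrable \<nu> (\<lambda>x. x\<^sup>2)"
    and ind: "indep_vars (\<lambda>k. borel_vec d) X {1..}"
    and distr_X: "\<And>k. 1 \<le> k \<Longrightarrow> distr M (borel_vec d) (X k) = \<mu>"
  defines "\<sigma>2 \<equiv> \<integral>x. x\<^sup>2 \<partial>\<nu>"
  shows "norm (char (distr M borel (\<lambda>\<omega>.
        ((vec_norm d (vec_sum d (\<lambda>k. X k \<omega>) {1..n}))\<^sup>2 - real n * \<sigma>2) / sqrt (real n))) t
      - char (distr \<nu> borel (\<lambda>x. x\<^sup>2 - \<sigma>2)) (t / sqrt (real n)) ^ n)
    \<le> \<bar>t\<bar> * sqrt (2 * \<sigma>2\<^sup>2 * ((real n)\<^sup>2 / real d))"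
proof -
  have prob_\<mu>: "prob_space \<mu>" and rad: "radial_measure d \<mu>"
    and norm_\<mu>: "distr \<mu> borel (vec_norm d) = \<nu>"
    using law by (auto simp: radial_law_of_def)
  have sets_\<mu> [measurable_cong]: "sets \<mu> = sets (borel_vec d)"
    using rad by (simp add: radial_measure_def)
  have int_\<mu>: "integrable \<mu> (\<lambda>x. (vec_norm d x)\<^sup>2)"
    using sq unfolding norm_\<mu>[symmetric] by (subst (asm) integrable_distr_eq) auto
  have \<sigma>2_\<mu>: "(\<integral>x. (vec_norm d x)\<^sup>2 \<partial>\<mu>) = \<sigma>2"
    unfolding \<sigma>2_def norm_\<mu>[symmetric] by (subst integral_distr) auto
  have X_meas: "X k \<in> measurable M (borel_vec d)" if "1 \<le> k" for k
    using ind that by (auto simp: indep_vars_def)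
  have mean: "has_bochner_integral M (\<lambda>\<omega>. X k \<omega> i) 0" if "1 \<le> k" "i < d" for k i
  proof -
    have "has_bochner_integral (distr M (borel_vec d) (X k)) (\<lambda>x. x i) 0"
      using radial_first_moment[OF prob_\<mu> rad int_\<mu> that(2)] unfolding distr_X[OF that(1)] .
    from has_bochner_integral_distrD[OF this borel_vec_component[OF that(2)] X_meas[OF that(1)]]
    show ?thesis .
  qed
  have cov: "has_bochner_integral M (\<lambda>\<omega>. X k \<omega> i * X k \<omega> j) (if i = j then \<sigma>2 / d else 0)"
    if "1 \<le> k" "i < d" "j < d" for k i j
  proof -
    have "has_bochner_integral (distr M (borel_vec d) (X k)) (\<lambda>x. x i * x j)
        (if i = j then \<sigma>2 / d else 0)"
      using radial_second_moments[OF prob_\<mu> rad int_\<mu> that(2,3)]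
      unfolding distr_X[OF that(1)] \<sigma>2_\<mu> .
    from has_bochner_integral_distrD[OF this _ X_meas[OF that(1)]] show ?thesis
      by (simp add: borel_measurable_times borel_vec_component that)
  qed
  note cross = cross_sum_second_moment[OF ind mean cov]

  define Z where "Z k \<omega> = ((vec_norm d (X k \<omega>))\<^sup>2 - \<sigma>2) / sqrt (real n)" for k \<omega>
  define R where "R \<omega> = cross_sum d (\<lambda>k. X k \<omega>) n / sqrt (real n)" for \<omega>
  have Z_ind: "indep_vars (\<lambda>_. borel) Z {1..n}"
    unfolding Z_def
    by (rule indep_vars_compose2[OF indep_vars_subset[OF ind]]) auto
  have Z_meas: "Z k \<in> borel_measurable M" if "1 \<le> k" for k
    using measurable_compose[OF X_meas[OF that], of "\<lambda>x. ((vec_norm d x)\<^sup>2 - \<sigma>2) / sqrt (real n)" borel]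
    by (simp add: Z_def[abs_def])
  have Z_char: "char (distr M borel (Z k)) t = char (distr \<nu> borel (\<lambda>x. x\<^sup>2 - \<sigma>2)) (t / sqrt n)"
    if "1 \<le> k" for k
  proof -
    have "char (distr M borel (Z k)) t = (\<integral>\<omega>. iexp (t * Z k \<omega>) \<partial>M)"
      unfolding char_def by (subst integral_distr) (auto intro: Z_meas[OF that])
    also have "\<dots> = (\<integral>x. iexp (t * (((vec_norm d x)\<^sup>2 - \<sigma>2) / sqrt n)) \<partial>\<mu>)"
      unfolding distr_X[OF that, symmetric] Z_def
      by (subst integral_distr) (auto intro: X_meas[OF that])
    also have "\<dots> = (\<integral>x. iexp (t * ((x\<^sup>2 - \<sigma>2) / sqrt n)) \<partial>\<nu>)"
      unfolding norm_\<mu>[symmetric] by (subst integral_distr) auto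
    also have "\<dots> = char (distr \<nu> borel (\<lambda>x. x\<^sup>2 - \<sigma>2)) (t / sqrt n)"
      unfolding char_def norm_\<mu>[symmetric] by (subst integral_distr) (auto simp: field_simps)
    finally show ?thesis .
  qed
  have R_meas: "R \<in> borel_measurable M"
  proof -
    have Xi: "(\<lambda>\<omega>. X k \<omega> i) \<in> borel_measurable M" if "1 \<le> k" "i < d" for k i
      by (rule measurable_borel_vec_component[OF that(2) X_meas[OF that(1)]])
    have "(\<lambda>\<omega>. cross_sum d (\<lambda>k. X k \<omega>) n) \<in> borel_measurable M"
      unfolding cross_sum_def
      by (intro borel_measurable_diff borel_measurable_sum borel_measurable_power Xi) auto
    then show ?thesis unfolding R_def by measurable
  qed
  have split: "((vec_norm d (vec_sum d (\<lambda>k. X k \<omega>) {1..n}))\<^sup>2 - real n * \<sigma>2) / sqrt (real n)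
      = (\<Sum>k\<in>{1..n}. Z k \<omega>) + R \<omega>" for \<omega>
  proof -
    have "(vec_norm d (vec_sum d (\<lambda>k. X k \<omega>) {1..n}))\<^sup>2
        = (\<Sum>k\<in>{1..n}. (vec_norm d (X k \<omega>))\<^sup>2) + cross_sum d (\<lambda>k. X k \<omega>) n"
      by (simp add: vec_norm_square vec_sum_def cross_sum_def)
    moreover have "(\<Sum>k\<in>{1..n}. Z k \<omega>)
        = ((\<Sum>k\<in>{1..n}. (vec_norm d (X k \<omega>))\<^sup>2) - real n * \<sigma>2) / sqrt (real n)"
      by (simp add: Z_def sum_divide_distrib[symmetric] sum_subtractf)
    ultimately show ?thesis by (simp add: R_def add_divide_distrib diff_divide_distrib)
  qed
  have R2: "has_bochner_integral M (\<lambda>\<omega>. (R \<omega>)\<^sup>2) (2 * (real n - 1) * \<sigma>2\<^sup>2 / d)"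
  proof -
    have "has_bochner_integral M (\<lambda>\<omega>. inverse (real n) * (cross_sum d (\<lambda>k. X k \<omega>) n)\<^sup>2)
        (inverse (real n) * (2 * real n * (real n - 1) * (\<sigma>2 / d)\<^sup>2 * real d))"
      by (intro has_bochner_integral_mult_right cross)
    moreover have "inverse (real n) * (2 * real n * (real n - 1) * (\<sigma>2 / d)\<^sup>2 * real d)
        = 2 * (real n - 1) * \<sigma>2\<^sup>2 / d"
      using n d by (simp add: field_simps power2_eq_square)
    ultimately show ?thesis
      by (simp add: R_def power_divide field_simps)
  qed
  have R2_le: "expectation (\<lambda>\<omega>. (R \<omega>)\<^sup>2) \<le> 2 * \<sigma>2\<^sup>2 * ((real n)\<^sup>2 / d)"
  proof -
    have "real n \<le> (real n)\<^sup>2" using n by (simp add: power2_eq_square)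
    then have "real n - 1 \<le> (real n)\<^sup>2" by linarith
    then have "(2 * \<sigma>2\<^sup>2 / d) * (real n - 1) \<le> (2 * \<sigma>2\<^sup>2 / d) * (real n)\<^sup>2"
      by (intro mult_left_mono) auto
    then show ?thesis
      using R2 by (simp add: has_bochner_integral_iff field_simps)
  qed
  have "char (distr M borel (\<lambda>\<omega>. \<Sum>k\<in>{1..n}. Z k \<omega>)) t
      = char (distr \<nu> borel (\<lambda>x. x\<^sup>2 - \<sigma>2)) (t / sqrt n) ^ n"
    using char_distr_sum[OF Z_ind, of t] Z_char by simp
  moreover have "norm (char (distr M borel (\<lambda>\<omega>. (\<Sum>k\<in>{1..n}. Z k \<omega>) + R \<omega>)) t
      - char (distr M borel (\<lambda>\<omega>. \<Sum>k\<in>{1..n}. Z k \<omega>)) t)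
    \<le> \<bar>t\<bar> * sqrt (expectation (\<lambda>\<omega>. (R \<omega>)\<^sup>2))"
    using R2
    by (intro char_perturbation R_meas borel_measurable_sum Z_meas)
      (auto simp: has_bochner_integral_iff)
  moreover have "\<bar>t\<bar> * sqrt (expectation (\<lambda>\<omega>. (R \<omega>)\<^sup>2)) \<le> \<bar>t\<bar> * sqrt (2 * \<sigma>2\<^sup>2 * ((real n)\<^sup>2 / d))"
    using R2_le by (intro mult_left_mono) auto
  ultimately show ?thesis
    unfolding split by simp
qed

text \<open>
  Levy's continuity theorem asks for probability laws at every index, whereas at \<open>n = 0\<close> the dimension
  may be \<open>0\<close>, where nothing is known about the space. The sequence is therefore shifted by one.
\<close>

lemma weak_conv_m_Suc_iff: "weak_conv_m (\<lambda>n. \<mu> (Suc n)) \<nu> \<longleftrightarrow> weak_conv_m \<mu> \<nu>"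
  unfolding weak_conv_m_def weak_conv_def by (simp add: filterlim_sequentially_Suc[of "\<lambda>n. cdf (\<mu> n) _"])

theorem theorem1p3:
  fixes \<nu> :: "real measure"
    and \<nu>d :: "nat \<Rightarrow> (nat \<Rightarrow> real) measure"
    and M :: "nat \<Rightarrow> 'a measure"
    and X :: "nat \<Rightarrow> nat \<Rightarrow> 'a \<Rightarrow> nat \<Rightarrow> real"
    and p :: "nat \<Rightarrow> nat"
    and \<sigma>2 m4 :: real
  assumes "prob_space \<nu>" and "sets \<nu> = sets borel" and "AE x in \<nu>. 0 \<le> x"
    and "integrable \<nu> (\<lambda>x. x ^ 4)"
    and "m4 = (\<integral>x. x ^ 4 \<partial>\<nu>)"
    and "\<sigma>2 = (\<integral>x. x ^ 2 \<partial>\<nu>)"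
    and "\<And>d. d \<ge> 1 \<Longrightarrow> radial_law_of \<nu> d (\<nu>d d)"
    and "\<And>d. d \<ge> 1 \<Longrightarrow> prob_space (M d)"
    and "\<And>d. d \<ge> 1 \<Longrightarrow> prob_space.indep_vars (M d) (\<lambda>k. borel_vec d) (X d) {1..}"
    and "\<And>d k. d \<ge> 1 \<Longrightarrow> k \<ge> 1 \<Longrightarrow> distr (M d) (borel_vec d) (X d k) = \<nu>d d"
    and "\<And>n. n \<ge> 1 \<Longrightarrow> p n \<ge> 1"
    and "(\<lambda>n. (real n) ^ 2 / real (p n)) \<longlonglongrightarrow> 0"
  shows "weak_conv_m
     (\<lambda>n. distr (M (p n)) borel
        (\<lambda>\<omega>. ((vec_norm (p n) (vec_sum (p n) (\<lambda>k. X (p n) k \<omega>) {1..n}))\<^sup>2 - real n * \<sigma>2) / sqrt (real n)))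
     (normal_law 0 (m4 - \<sigma>2 ^ 2))"
proof -
  interpret \<nu>: prob_space \<nu> by fact
  note [measurable_cong] = \<open>sets \<nu> = sets borel\<close>
  have int4: "integrable \<nu> (\<lambda>x. (x\<^sup>2)\<^sup>2)" using assms(4) by simp
  have int2: "integrable \<nu> (\<lambda>x. x\<^sup>2)"
    by (rule \<nu>.square_integrable_imp_integrable[OF _ int4]) measurable
  define v where "v = m4 - \<sigma>2\<^sup>2"
  define \<rho> where "\<rho> = distr \<nu> borel (\<lambda>x. x\<^sup>2 - \<sigma>2)"
  have var: "\<nu>.variance (\<lambda>x. x\<^sup>2) = v"
    using int2 int4 by (subst \<nu>.variance_eq) (auto simp: v_def assms(5,6))
  then have v0: "0 \<le> v" using \<nu>.variance_positive[of "\<lambda>x. x\<^sup>2"] by simp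
  interpret \<rho>: real_distribution \<rho>
    unfolding \<rho>_def by (rule \<nu>.real_distribution_distr) measurable
  have int_sq: "integrable \<nu> (\<lambda>x. (x\<^sup>2 - \<sigma>2)\<^sup>2)"
    using int2 int4 unfolding power2_diff by simp
  have clt: "(\<lambda>n. char \<rho> (t / sqrt (real n)) ^ n) \<longlonglongrightarrow> complex_of_real (exp (- (v * t\<^sup>2) / 2))" for t
  proof (rule \<rho>.char_power_tendsto_normal)
    show "integrable \<rho> (\<lambda>x. x)" "integrable \<rho> (\<lambda>x. x\<^sup>2)"
      using int2 int_sq unfolding \<rho>_def by (simp_all add: integrable_distr_eq)
    show "\<rho>.expectation (\<lambda>x. x) = 0"
      using int2 unfolding \<rho>_def by (simp add: integral_distr assms(6) \<nu>.prob_space)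
    show "\<rho>.expectation (\<lambda>x. x\<^sup>2) = v"
      using var unfolding \<rho>_def by (simp add: integral_distr assms(6))
  qed
  let ?Y = "\<lambda>n \<omega>. ((vec_norm (p n) (vec_sum (p n) (\<lambda>k. X (p n) k \<omega>) {1..n}))\<^sup>2 - real n * \<sigma>2)
    / sqrt (real n)"
  let ?L = "\<lambda>n. distr (M (p n)) borel (?Y n)"
  have dist: "real_distribution (?L n)" if n: "1 \<le> n" for n
  proof -
    interpret prob_space "M (p n)" using assms(8,11) n by blast
    have X_meas: "X (p n) k \<in> measurable (M (p n)) (borel_vec (p n))" if "1 \<le> k" for k
      using assms(9)[OF assms(11)[OF n]] that by (auto simp: indep_vars_def)
    have Xi: "(\<lambda>\<omega>. X (p n) k \<omega> i) \<in> borel_measurable (M (p n))" if "1 \<le> k" "i < p n" for k i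
      by (rule measurable_borel_vec_component[OF that(2) X_meas[OF that(1)]])
    have "(\<lambda>\<omega>. \<Sum>i<p n. (\<Sum>k\<in>{1..n}. X (p n) k \<omega> i)\<^sup>2) \<in> borel_measurable (M (p n))"
      by (intro borel_measurable_sum borel_measurable_power Xi) auto
    then have "?Y n \<in> borel_measurable (M (p n))"
      by (simp add: vec_norm_square vec_sum_def)
    then show ?thesis by (rule real_distribution_distr)
  qed
  have bound: "norm (char (?L n) t - char \<rho> (t / sqrt (real n)) ^ n)
      \<le> \<bar>t\<bar> * sqrt (2 * \<sigma>2\<^sup>2 * ((real n)\<^sup>2 / real (p n)))" if n: "1 \<le> n" for n t
  proof -
    have p: "1 \<le> p n" using assms(11) n by blast
    show ?thesis
      using prob_space.char_radial_walk_approx[OF assms(8)[OF p] p n assms(7)[OF p] int2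
          assms(9)[OF p] assms(10)[OF p]]
      unfolding \<rho>_def assms(6) by simp
  qed
  have "(\<lambda>n. char (?L n) t) \<longlonglongrightarrow> char (normal_law 0 v) t" for t
  proof -
    have "(\<lambda>n. \<bar>t\<bar> * sqrt (2 * \<sigma>2\<^sup>2 * ((real n)\<^sup>2 / real (p n)))) \<longlonglongrightarrow> \<bar>t\<bar> * sqrt (2 * \<sigma>2\<^sup>2 * 0)"
      by (intro tendsto_intros assms(12))
    then have "(\<lambda>n. \<bar>t\<bar> * sqrt (2 * \<sigma>2\<^sup>2 * ((real n)\<^sup>2 / real (p n)))) \<longlonglongrightarrow> 0" by simp
    then have "(\<lambda>n. char (?L n) t - char \<rho> (t / sqrt (real n)) ^ n) \<longlonglongrightarrow> 0"
      by (rule Lim_null_comparison[rotated]) (use bound in \<open>auto intro!: eventually_sequentiallyI[of 1]\<close>)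
    from Lim_transform[OF clt this] show ?thesis
      by (simp add: char_normal_law[OF v0])
  qed
  then have "weak_conv_m (\<lambda>n. ?L (Suc n)) (normal_law 0 v)"
    by (intro levy_continuity dist real_distribution_normal_law v0
        LIMSEQ_Suc[where f = "\<lambda>n. char (?L n) _"]) simp_all
  then have "weak_conv_m ?L (normal_law 0 v)"
    by (simp only: weak_conv_m_Suc_iff[of ?L])
  then show ?thesis by (simp only: v_def)
qed

end
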